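(* Let $n\ge 2$ and $0<\theta<\pi/2$. Then $$B(n,\theta)\le\frac{A(n-1,\tilde\theta)+A(n,\theta)}{2},\qquad\text{where }\ \cos\tilde\theta=\frac{\cos\theta}{\cos(\theta/2)},\ \tilde\theta\in[0,\pi].$$
   Context: $S^{n-1}$ is the unit sphere in $\mathbb R^n$ with angular distance $\operatorname{dist}$, and $e_n=(0,\dots,0,1)$. A finite set $C\subset S^{n-1}$ is a $\theta$-code if $\operatorname{dist}(x,y)\ge\theta$ for all distinct $x,y\in C$. $A(n,\theta)$ is the maximum size of a $\theta$-code in $S^{n-1}$, and $B(n,\theta)$ is the maximum size of a $\theta$-code contained in the closed hemisphere $\{x\in S^{n-1}:\langle x,e_n\rangle\ge0\}$. *)

theory Defs
  imports Complex_Main "Jordan_Normal_Form.Matrix"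
begin

text \<open>
  The dimension varies within one statement, so \<open>\<real>\<^sup>n\<close> is \<open>carrier_vec n\<close>. Coordinates are
  counted from 0, so \<open>e\<^sub>n\<close> is \<open>unit_vec n (n - 1)\<close>.
\<close>

definition unit_sphere :: "nat \<Rightarrow> real vec set" where
  "unit_sphere n = {x \<in> carrier_vec n. sqrt (scalar_prod x x) = 1}"

definition angular_dist :: "real vec \<Rightarrow> real vec \<Rightarrow> real" where
  "angular_dist x y = arccos (scalar_prod x y)"

definition spherical_code :: "nat \<Rightarrow> real \<Rightarrow> real vec set \<Rightarrow> bool" where
  "spherical_code n \<theta> C \<longleftrightarrow>
     finite C \<and> C \<subseteq> unit_sphere n \<and> (\<forall>x\<in>C. \<forall>y\<in>C. x \<noteq> y \<longrightarrow> \<theta> \<le> angular_dist x y)"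

definition closed_hemisphere :: "nat \<Rightarrow> real vec set" where
  "closed_hemisphere n = {x \<in> unit_sphere n. 0 \<le> scalar_prod x (unit_vec n (n - 1))}"

text \<open>
  For \<open>0 < \<theta>\<close> the sizes of codes are bounded, by compactness of the sphere, so both maxima
  below exist; for other \<open>\<theta>\<close> the values need not be meaningful.
\<close>

definition max_code_size :: "nat \<Rightarrow> real \<Rightarrow> nat" where
  "max_code_size n \<theta> = Max {card C | C. spherical_code n \<theta> C}"

definition max_hemisphere_code_size :: "nat \<Rightarrow> real \<Rightarrow> nat" where
  "max_hemisphere_code_size n \<theta> =
     Max {card C | C. spherical_code n \<theta> C \<and> C \<subseteq> closed_hemisphere n}"

end

theory Submission
  imports Defs "HOL-Library.FuncSet"
begin

text \<open>
  Let \<open>C\<close> be a largest \<open>\<theta>\<close>-code in the hemisphere, and split it by height above the equator: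
  \<open>D\<close> consists of the points at height at least \<open>sin (\<theta> / 2)\<close>, that is, at latitude at least
  \<open>\<theta> / 2\<close>, and \<open>E\<close> of the others. Two codes are built from these parts.

  \<^item> Add to \<open>C\<close> the mirror image of \<open>D\<close> in the equator. A reflected point of \<open>D\<close> is
    at least \<open>\<theta>\<close> away from every point of \<open>D\<close> because both have latitude at least \<open>\<theta> / 2\<close>, on
    opposite sides of the equator; and it is no closer to a point of \<open>E\<close> than its
    original, since \<open>E\<close> lies on the side of the original. So this is a \<open>\<theta>\<close>-code, and \<open>2 |D| + |E| \<le> A(n, \<theta>)\<close>.

  \<^item> Project \<open>E\<close> along meridians to the equator, which is a sphere of one dimension less. If the
    two heights are \<open>s \<le> t < sin (\<theta> / 2)\<close>, with cosines of latitude \<open>u\<close> and \<open>v\<close>, then the cosine of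
    the distance of the projections is at most \<open>(cos \<theta> - s t) / (u v)\<close>, and an elementary estimate
    bounds this by \<open>cos \<theta> / cos (\<theta> / 2)\<close>. So this is a \<open>\<theta>'\<close>-code, and \<open>|E| \<le> A(n - 1, \<theta>')\<close>.

  Adding the two bounds gives \<open>2 |C| \<le> A(n - 1, \<theta>') + A(n, \<theta>)\<close>. The maxima over code sizes are
  meaningful because a pigeonhole argument on a grid bounds the size of a \<open>\<theta>\<close>-code.
\<close>

section \<open>Codes in terms of scalar products\<close>

lemma scalar_prod_sum:
  fixes x y :: "real vec"
  assumes "y \<in> carrier_vec n"
  shows "x \<bullet> y = (\<Sum>i<n. x $ i * y $ i)"
  using assms by (simp add: scalar_prod_def lessThan_atLeast0)

lemma sum_power2_diff:
  fixes f g :: "'a \<Rightarrow> real"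
  shows "(\<Sum>i\<in>A. (f i - g i)\<^sup>2) =
    (\<Sum>i\<in>A. f i * f i) + (\<Sum>i\<in>A. g i * g i) - 2 * (\<Sum>i\<in>A. f i * g i)"
proof -
  have "(f i - g i)\<^sup>2 = f i * f i + g i * g i - 2 * (f i * g i)" for i
    by (simp add: power2_eq_square algebra_simps)
  then show ?thesis
    by (simp add: sum.distrib sum_subtractf sum_distrib_left)
qed

lemma scalar_prod_le_half_norms:
  fixes x y :: "real vec"
  assumes "x \<in> carrier_vec n" "y \<in> carrier_vec n"
  shows "\<bar>x \<bullet> y\<bar> \<le> (x \<bullet> x + y \<bullet> y) / 2"
proof -
  \<comment> \<open>The sum is written as a difference so that one expansion formula covers both signs.\<close>
  have "0 \<le> (\<Sum>i<n. (x $ i - y $ i)\<^sup>2)" "0 \<le> (\<Sum>i<n. (x $ i - - y $ i)\<^sup>2)"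
    by (simp_all only: sum_nonneg zero_le_power2)
  then show ?thesis
    using assms unfolding sum_power2_diff by (simp add: scalar_prod_sum sum_negf)
qed

lemma unit_sphere_iff: "x \<in> unit_sphere n \<longleftrightarrow> x \<in> carrier_vec n \<and> x \<bullet> x = 1"
  by (auto simp: unit_sphere_def)

lemma le_angular_dist_iff:
  assumes "x \<in> unit_sphere n" "y \<in> unit_sphere n" "0 \<le> \<theta>" "\<theta> \<le> pi"
  shows "\<theta> \<le> angular_dist x y \<longleftrightarrow> x \<bullet> y \<le> cos \<theta>"
proof -
  have "\<bar>x \<bullet> y\<bar> \<le> 1"
    using scalar_prod_le_half_norms[of x n y] assms by (simp add: unit_sphere_iff)
  then show ?thesis
    using assms arccos_le_mono[of "cos \<theta>" "x \<bullet> y"]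
    by (simp add: angular_dist_def arccos_cos)
qed

lemma spherical_code_iff:
  assumes "0 \<le> \<theta>" "\<theta> \<le> pi"
  shows "spherical_code n \<theta> C \<longleftrightarrow>
    finite C \<and> C \<subseteq> unit_sphere n \<and> (\<forall>x\<in>C. \<forall>y\<in>C. x \<noteq> y \<longrightarrow> x \<bullet> y \<le> cos \<theta>)"
proof -
  have "\<theta> \<le> angular_dist x y \<longleftrightarrow> x \<bullet> y \<le> cos \<theta>" if "C \<subseteq> unit_sphere n" "x \<in> C" "y \<in> C" for x y
    using that assms by (intro le_angular_dist_iff[of _ n]) auto
  then show ?thesis
    unfolding spherical_code_def by blast
qed

section \<open>The maxima exist\<close>

text \<open>
  Round the coordinates down to multiples of \<open>1 / N\<close>, where \<open>N\<close> is so large that two unit vectors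
  with the same rounding are closer than \<open>\<theta>\<close>. Then a code injects into the finite set of
  roundings.
\<close>

lemma spherical_code_size_bounded:
  assumes "0 < \<theta>" "\<theta> \<le> pi"
  shows "\<exists>K. \<forall>C. spherical_code n \<theta> C \<longrightarrow> card C \<le> K"
proof -
  have c1: "cos \<theta> < 1"
    using assms cos_monotone_0_pi[of 0 \<theta>] by simp
  obtain N :: nat where N: "real n / (1 - cos \<theta>) < real N"
    using reals_Archimedean2 by blast
  have "0 \<le> real n / (1 - cos \<theta>)"
    using c1 by simp
  with N have "0 < real N"
    by linarith
  then have Npos: "1 \<le> real N"
    by simp
  define R where "R x = (\<lambda>i\<in>{..<n}. \<lfloor>real N * x $ i\<rfloor>)" for x :: "real vec"
  define G where "G = PiE {..<n} (\<lambda>_. {- int N..int N})"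
  have finG: "finite G"
    unfolding G_def by (intro finite_PiE) auto
  have "card C \<le> card G" if C: "spherical_code n \<theta> C" for C
  proof (rule card_inj_on_le[OF _ _ finG])
    have sub: "C \<subseteq> unit_sphere n" and sep: "\<And>x y. x \<in> C \<Longrightarrow> y \<in> C \<Longrightarrow> x \<noteq> y \<Longrightarrow> x \<bullet> y \<le> cos \<theta>"
      using C assms by (auto simp: spherical_code_iff)
    show "R ` C \<subseteq> G"
    proof (clarsimp simp: R_def G_def PiE_iff)
      fix x i assume x: "x \<in> C" and i: "i < n"
      have "(x $ i)\<^sup>2 \<le> (\<Sum>i<n. (x $ i)\<^sup>2)"
        using i by (intro member_le_sum) auto
      also have "\<dots> = 1"
        using x sub by (auto simp: unit_sphere_iff power2_eq_square simp flip: scalar_prod_sum)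
      finally have "\<bar>x $ i\<bar> \<le> 1"
        by (simp add: abs_square_le_1)
      then have "\<bar>real N * x $ i\<bar> \<le> real N"
        using Npos by (simp add: abs_mult)
      then show "- int N \<le> \<lfloor>real N * x $ i\<rfloor> \<and> \<lfloor>real N * x $ i\<rfloor> \<le> int N"
        by linarith
    qed
    show "inj_on R C"
    proof (rule inj_onI, rule ccontr)
      fix x y assume x: "x \<in> C" and y: "y \<in> C" and eq: "R x = R y" and ne: "x \<noteq> y"
      have xy: "x \<in> carrier_vec n" "y \<in> carrier_vec n" "x \<bullet> x = 1" "y \<bullet> y = 1"
        using x y sub by (auto simp: unit_sphere_iff)
      have close: "(x $ i - y $ i)\<^sup>2 \<le> 1 / real N" if "i < n" for i
      proof -
        have "\<lfloor>real N * x $ i\<rfloor> = \<lfloor>real N * y $ i\<rfloor>"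
          using fun_cong[OF eq, of i] that by (simp add: R_def)
        then have "\<bar>real N * x $ i - real N * y $ i\<bar> \<le> 1"
          by linarith
        then have "(real N * x $ i - real N * y $ i)\<^sup>2 \<le> 1"
          by (simp add: abs_square_le_1)
        then have "(real N)\<^sup>2 * (x $ i - y $ i)\<^sup>2 \<le> 1"
          by (simp add: power_mult_distrib flip: right_diff_distrib)
        moreover have "real N * (x $ i - y $ i)\<^sup>2 \<le> (real N)\<^sup>2 * (x $ i - y $ i)\<^sup>2"
          using Npos by (intro mult_right_mono) (auto simp: self_le_power)
        ultimately show ?thesis
          using Npos by (simp add: field_simps)
      qed
      have "2 - 2 * (x \<bullet> y) = (\<Sum>i<n. (x $ i - y $ i)\<^sup>2)"
      proof -
        have "(\<Sum>i<n. (x $ i - y $ i)\<^sup>2) = x \<bullet> x + y \<bullet> y - 2 * (x \<bullet> y)"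
          using xy(1,2) by (simp add: scalar_prod_sum sum_power2_diff)
        then show ?thesis
          using xy by simp
      qed
      also have "\<dots> \<le> (\<Sum>i<n. 1 / real N)"
        using close by (intro sum_mono) simp
      also have "\<dots> = real n / real N"
        by simp
      also have "\<dots> < 1 - cos \<theta>"
        using N Npos c1 by (simp add: field_simps)
      finally show False
        using sep[OF x y ne] c1 by simp
    qed
  qed
  then show ?thesis
    by blast
qed

lemma finite_code_sizes:
  assumes "0 < \<theta>" "\<theta> \<le> pi"
  shows "finite {card C | C. spherical_code n \<theta> C}"
proof -
  obtain K where "\<And>C. spherical_code n \<theta> C \<Longrightarrow> card C \<le> K"
    using spherical_code_size_bounded[OF assms] by blast
  then have "{card C | C. spherical_code n \<theta> C} \<subseteq> {..K}"
    by auto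
  then show ?thesis
    by (rule finite_subset) simp
qed

lemma card_le_max_code_size:
  assumes "spherical_code n \<theta> C" "0 < \<theta>" "\<theta> \<le> pi"
  shows "card C \<le> max_code_size n \<theta>"
  unfolding max_code_size_def using assms by (intro Max_ge finite_code_sizes) auto

lemma max_hemisphere_code_size_attained:
  assumes "0 < \<theta>" "\<theta> \<le> pi"
  obtains C where "spherical_code n \<theta> C" "C \<subseteq> closed_hemisphere n"
    "card C = max_hemisphere_code_size n \<theta>"
proof -
  let ?S = "{card C | C. spherical_code n \<theta> C \<and> C \<subseteq> closed_hemisphere n}"
  have "finite ?S"
    by (rule finite_subset[OF _ finite_code_sizes[OF assms]]) auto
  moreover have "spherical_code n \<theta> {} \<and> {} \<subseteq> closed_hemisphere n"
    by (simp add: spherical_code_def)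
  then have "?S \<noteq> {}"
    by blast
  ultimately have "Max ?S \<in> ?S"
    by (rule Max_in)
  then show ?thesis
    using that unfolding max_hemisphere_code_size_def by auto
qed

section \<open>Adding the mirror image of the high points\<close>

lemma scalar_prod_Suc:
  fixes x y :: "real vec"
  assumes "y \<in> carrier_vec (Suc m)"
  shows "x \<bullet> y = (\<Sum>i<m. x $ i * y $ i) + x $ m * y $ m"
  using assms by (simp add: scalar_prod_sum)

lemma closed_hemisphere_Suc_iff:
  "x \<in> closed_hemisphere (Suc m) \<longleftrightarrow> x \<in> unit_sphere (Suc m) \<and> 0 \<le> x $ m"
  by (auto simp: closed_hemisphere_def unit_sphere_iff)

definition equator_reflection :: "nat \<Rightarrow> real vec \<Rightarrow> real vec" where
  "equator_reflection m x = vec (Suc m) (\<lambda>i. if i = m then - x $ i else x $ i)"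

lemma equator_reflection_carrier [simp]: "equator_reflection m x \<in> carrier_vec (Suc m)"
  by (simp add: equator_reflection_def)

lemma equator_reflection_height [simp]: "equator_reflection m x $ m = - x $ m"
  by (simp add: equator_reflection_def)

lemma equator_reflection_nth [simp]: "i < m \<Longrightarrow> equator_reflection m x $ i = x $ i"
  by (simp add: equator_reflection_def)

lemma equator_reflection_involution:
  "x \<in> carrier_vec (Suc m) \<Longrightarrow> equator_reflection m (equator_reflection m x) = x"
  by (rule eq_vecI) (auto simp: equator_reflection_def)

lemma scalar_prod_equator_reflection:
  assumes "y \<in> carrier_vec (Suc m)"
  shows "x \<bullet> equator_reflection m y = x \<bullet> y - 2 * (x $ m * y $ m)"
    and "equator_reflection m x \<bullet> equator_reflection m y = x \<bullet> y"
    and "equator_reflection m x \<bullet> y = x \<bullet> y - 2 * (x $ m * y $ m)"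
  using assms by (simp_all add: scalar_prod_Suc[of _ m])

lemma equator_reflection_unit_sphere:
  "x \<in> unit_sphere (Suc m) \<Longrightarrow> equator_reflection m x \<in> unit_sphere (Suc m)"
  by (simp add: unit_sphere_iff scalar_prod_equator_reflection)

text \<open>
  The chord from \<open>x\<close> to the mirror image of \<open>y\<close> is at least the sum of the two heights, hence at
  least \<open>2 sin (\<theta> / 2)\<close>, which is the chord that subtends the angle \<open>\<theta>\<close>.
\<close>

lemma high_points_far_from_reflections:
  assumes x: "x \<in> unit_sphere (Suc m)" and y: "y \<in> unit_sphere (Suc m)"
    and high: "sin (\<theta> / 2) \<le> x $ m" "sin (\<theta> / 2) \<le> y $ m" and pos: "0 \<le> sin (\<theta> / 2)"
  shows "x \<bullet> equator_reflection m y \<le> cos \<theta>"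
proof -
  define P where "P = (\<Sum>i<m. x $ i * y $ i)"
  have "0 \<le> (\<Sum>i<m. (x $ i - y $ i)\<^sup>2)"
    by (simp add: sum_nonneg)
  also have "\<dots> = (\<Sum>i<m. x $ i * x $ i) + (\<Sum>i<m. y $ i * y $ i) - 2 * P"
    by (simp add: P_def sum_power2_diff)
  also have "\<dots> = (1 - (x $ m)\<^sup>2) + (1 - (y $ m)\<^sup>2) - 2 * P"
    using x y scalar_prod_Suc[of x m x] scalar_prod_Suc[of y m y]
    by (simp add: unit_sphere_iff power2_eq_square)
  finally have "2 * (P - x $ m * y $ m) \<le> 2 - (x $ m + y $ m)\<^sup>2"
    by (simp add: power2_eq_square algebra_simps)
  moreover have "(2 * sin (\<theta> / 2))\<^sup>2 \<le> (x $ m + y $ m)\<^sup>2"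
    using high pos by (intro power_mono) auto
  moreover have "cos \<theta> = 1 - 2 * (sin (\<theta> / 2))\<^sup>2"
    using cos_double_sin[of "\<theta> / 2"] by simp
  moreover have "x \<bullet> equator_reflection m y = P - x $ m * y $ m"
    using y by (simp add: unit_sphere_iff scalar_prod_equator_reflection)
      (simp add: scalar_prod_Suc[of _ m] P_def)
  ultimately show ?thesis
    by (simp add: power_mult_distrib)
qed

lemma spherical_code_add_reflections:
  assumes \<theta>: "0 < \<theta>" "\<theta> \<le> pi"
    and code: "spherical_code (Suc m) \<theta> C" and hemi: "C \<subseteq> closed_hemisphere (Suc m)"
    and D: "D = {x \<in> C. sin (\<theta> / 2) \<le> x $ m}"
  shows "spherical_code (Suc m) \<theta> (C \<union> equator_reflection m ` D)"
    and "card (C \<union> equator_reflection m ` D) = card C + card D"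
proof -
  let ?r = "equator_reflection m"
  have fin: "finite C" and sphere: "C \<subseteq> unit_sphere (Suc m)"
    and sep: "\<And>x y. x \<in> C \<Longrightarrow> y \<in> C \<Longrightarrow> x \<noteq> y \<Longrightarrow> x \<bullet> y \<le> cos \<theta>"
    using code \<theta> by (auto simp: spherical_code_iff)
  have carrier: "x \<in> carrier_vec (Suc m)" and nonneg: "0 \<le> x $ m" if "x \<in> C" for x
    using that sphere hemi by (auto simp: unit_sphere_iff closed_hemisphere_Suc_iff)
  have DC: "D \<subseteq> C"
    by (simp add: D)
  have pos: "0 < sin (\<theta> / 2)"
    using \<theta> by (intro sin_gt_zero) auto
  have mixed: "x \<bullet> ?r y \<le> cos \<theta>" if "x \<in> C" "y \<in> D" for x y
  proof (cases "x \<in> D")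
    case True
    then show ?thesis
      using that high_points_far_from_reflections[of x m y \<theta>] sphere pos by (auto simp: D)
  next
    case False
    \<comment> \<open>Reflecting \<open>y\<close> does not bring it closer to \<open>x\<close>, as both lie on the same side of the equator.\<close>
    have "y \<in> C"
      using that DC by blast
    moreover from this False that have "x \<bullet> y \<le> cos \<theta>"
      by (intro sep) auto
    moreover have "0 \<le> x $ m * y $ m"
      using nonneg that(1) \<open>y \<in> C\<close> by simp
    ultimately show ?thesis
      by (simp add: scalar_prod_equator_reflection carrier)
  qed
  have "x \<bullet> y \<le> cos \<theta>" if xy: "x \<in> C \<union> ?r ` D" "y \<in> C \<union> ?r ` D" "x \<noteq> y" for x y
  proof -
    consider "x \<in> C" "y \<in> C" | b where "x \<in> C" "b \<in> D" "y = ?r b"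
      | a where "a \<in> D" "x = ?r a" "y \<in> C"
      | a b where "a \<in> D" "x = ?r a" "b \<in> D" "y = ?r b"
      using xy by blast
    then show ?thesis
    proof cases
      case 1
      then show ?thesis using sep xy by blast
    next
      case 2
      then show ?thesis using mixed by blast
    next
      case (3 a)
      then have "x \<bullet> y = y \<bullet> x"
        using carrier by (intro comm_scalar_prod[of _ "Suc m"]) auto
      then show ?thesis using mixed 3 by simp
    next
      case (4 a b)
      then have "x \<bullet> y = a \<bullet> b"
        using carrier DC by (auto simp: scalar_prod_equator_reflection)
      also have "\<dots> \<le> cos \<theta>"
        using 4 xy(3) DC by (intro sep) auto
      finally show ?thesis .
    qed
  qed
  then show "spherical_code (Suc m) \<theta> (C \<union> ?r ` D)"
    using \<theta> fin sphere DC finite_subset[OF DC fin]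
    by (auto simp: spherical_code_iff equator_reflection_unit_sphere subset_iff)
  have "C \<inter> ?r ` D = {}"
    using nonneg pos by (force simp: D)
  moreover have "inj_on ?r D"
    using carrier DC equator_reflection_involution by (metis inj_onI subsetD)
  ultimately show "card (C \<union> ?r ` D) = card C + card D"
    using fin finite_subset[OF DC fin] by (simp add: card_Un_disjoint card_image)
qed

section \<open>Projecting the low points to the equator\<close>

definition equator_projection :: "nat \<Rightarrow> real vec \<Rightarrow> real vec" where
  "equator_projection m x = vec m (\<lambda>i. x $ i / sqrt (1 - (x $ m)\<^sup>2))"

lemma scalar_prod_equator_projection:
  assumes "y \<in> carrier_vec (Suc m)"
  shows "equator_projection m x \<bullet> equator_projection m y =
    (x \<bullet> y - x $ m * y $ m) / (sqrt (1 - (x $ m)\<^sup>2) * sqrt (1 - (y $ m)\<^sup>2))"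
proof -
  have "equator_projection m x \<bullet> equator_projection m y =
      (\<Sum>i<m. x $ i * y $ i / (sqrt (1 - (x $ m)\<^sup>2) * sqrt (1 - (y $ m)\<^sup>2)))"
    by (simp add: scalar_prod_sum[of _ m] equator_projection_def)
  then show ?thesis
    using assms by (simp add: scalar_prod_Suc sum_divide_distrib)
qed

text \<open>
  Here \<open>c = cos \<theta>\<close>, \<open>k = cos (\<theta> / 2)\<close>, and \<open>u\<close>, \<open>v\<close> are the cosines of the latitudes of points at
  heights \<open>s\<close>, \<open>t\<close>. As \<open>v / k \<ge> 1\<close>, it is enough that \<open>c (1 - u) \<le> s t\<close>; and
  \<open>1 - u \<le> 1 - u\<^sup>2 = s\<^sup>2 \<le> s t\<close>. The last inequality is why the cosine at the
  lower of the two heights is the one to be kept.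
\<close>

lemma meridian_projection_estimate:
  fixes c k s t u v :: real
  assumes "0 \<le> c" "c \<le> 1" "0 < k" "0 \<le> s" "s \<le> t" "0 \<le> u" "u \<le> 1" "u\<^sup>2 = 1 - s\<^sup>2" "k \<le> v"
  shows "c - s * t \<le> (c / k) * (u * v)"
proof -
  have "c * (1 - u) \<le> 1 * (1 - u)"
    using assms by (intro mult_right_mono) auto
  also have "\<dots> \<le> (1 + u) * (1 - u)"
    using assms by (intro mult_right_mono) auto
  also have "\<dots> = s * s"
    using assms by (simp add: power2_eq_square algebra_simps)
  also have "\<dots> \<le> s * t"
    using assms by (intro mult_left_mono) auto
  finally have "c - s * t \<le> c * u"
    by (simp add: algebra_simps)
  also have "\<dots> \<le> c * u * (v / k)"
    using mult_left_mono[of 1 "v / k" "c * u"] assms by simp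
  finally show ?thesis
    by (simp add: mult_ac)
qed

lemma equator_projection_low_points:
  assumes \<theta>: "0 < \<theta>" "\<theta> < pi / 2"
    and x: "x \<in> unit_sphere (Suc m)" "0 \<le> x $ m" "x $ m < sin (\<theta> / 2)"
    and y: "y \<in> unit_sphere (Suc m)" "0 \<le> y $ m" "y $ m < sin (\<theta> / 2)"
    and sep: "x \<bullet> y \<le> cos \<theta>"
  shows "equator_projection m x \<bullet> equator_projection m y \<le> cos \<theta> / cos (\<theta> / 2)"
proof -
  have k: "0 < cos (\<theta> / 2)" and c: "0 \<le> cos \<theta>"
    using \<theta> by (auto intro!: cos_gt_zero_pi cos_ge_zero)
  define w :: "real \<Rightarrow> real" where "w s = sqrt (1 - s\<^sup>2)" for s
  have w: "cos (\<theta> / 2) \<le> w s" "0 < w s" "w s \<le> 1" "(w s)\<^sup>2 = 1 - s\<^sup>2"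
    if "0 \<le> s" "s < sin (\<theta> / 2)" for s
  proof -
    have "s\<^sup>2 \<le> (sin (\<theta> / 2))\<^sup>2"
      using that by (intro power_mono) auto
    then have "(cos (\<theta> / 2))\<^sup>2 \<le> 1 - s\<^sup>2"
      by (simp add: cos_squared_eq)
    then show *: "cos (\<theta> / 2) \<le> w s"
      by (simp add: w_def real_le_rsqrt)
    then show "0 < w s"
      using k by linarith
    then show "(w s)\<^sup>2 = 1 - s\<^sup>2"
      by (simp add: w_def)
    show "w s \<le> 1"
      by (simp add: w_def)
  qed
  let ?s = "x $ m" and ?t = "y $ m"
  have "cos \<theta> - ?s * ?t \<le> cos \<theta> / cos (\<theta> / 2) * (w ?s * w ?t)"
  proof (cases "?s \<le> ?t")
    case True
    then show ?thesis
      using w[OF x(2,3)] w[OF y(2,3)] x(2) k c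
      by (intro meridian_projection_estimate) auto
  next
    case False
    then have "cos \<theta> - ?t * ?s \<le> cos \<theta> / cos (\<theta> / 2) * (w ?t * w ?s)"
      using w[OF x(2,3)] w[OF y(2,3)] y(2) k c
      by (intro meridian_projection_estimate) auto
    then show ?thesis
      by (simp add: mult_ac)
  qed
  with sep have "x \<bullet> y - ?s * ?t \<le> cos \<theta> / cos (\<theta> / 2) * (w ?s * w ?t)"
    by linarith
  moreover have "0 < w ?s * w ?t"
    using w(2) x y by simp
  ultimately have "(x \<bullet> y - ?s * ?t) / (w ?s * w ?t) \<le> cos \<theta> / cos (\<theta> / 2)"
    by (simp add: pos_divide_le_eq)
  then show ?thesis
    using y(1) by (simp add: scalar_prod_equator_projection unit_sphere_iff w_def)
qed

lemma spherical_code_equator_projection: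
  assumes \<theta>: "0 < \<theta>" "\<theta> < pi / 2"
    and \<theta>': "0 < \<theta>'" "\<theta>' \<le> pi" "cos \<theta>' = cos \<theta> / cos (\<theta> / 2)"
    and code: "spherical_code (Suc m) \<theta> E"
    and low: "\<And>x. x \<in> E \<Longrightarrow> 0 \<le> x $ m \<and> x $ m < sin (\<theta> / 2)"
  shows "spherical_code m \<theta>' (equator_projection m ` E)"
    and "card (equator_projection m ` E) = card E"
proof -
  let ?p = "equator_projection m"
  have fin: "finite E" and sphere: "E \<subseteq> unit_sphere (Suc m)"
    and sep: "\<And>x y. x \<in> E \<Longrightarrow> y \<in> E \<Longrightarrow> x \<noteq> y \<Longrightarrow> x \<bullet> y \<le> cos \<theta>"
    using code \<theta> by (auto simp: spherical_code_iff)
  have unit: "?p x \<in> unit_sphere m" if "x \<in> E" for x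
  proof -
    have "x $ m < 1"
      using low[OF that] sin_le_one[of "\<theta> / 2"] by linarith
    then have "(x $ m)\<^sup>2 < 1"
      using low[OF that] by (simp add: abs_square_less_1)
    moreover have "x \<in> carrier_vec (Suc m)" "x \<bullet> x = 1"
      using that sphere by (auto simp: unit_sphere_iff)
    ultimately have "?p x \<bullet> ?p x = 1"
      by (simp add: scalar_prod_equator_projection power2_eq_square)
    then show ?thesis
      by (simp add: unit_sphere_iff equator_projection_def)
  qed
  have psep: "?p x \<bullet> ?p y \<le> cos \<theta>'" if "x \<in> E" "y \<in> E" "x \<noteq> y" for x y
    using that low sphere sep \<theta> \<theta>'(3) equator_projection_low_points[of \<theta> x m y] by auto
  show "spherical_code m \<theta>' (?p ` E)"
    using fin unit psep \<theta>' by (auto simp: spherical_code_iff)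
  \<comment> \<open>Distinct points keep a positive distance, so the projection identifies no two of them.\<close>
  have "cos \<theta>' < 1"
    using \<theta>' cos_monotone_0_pi[of 0 \<theta>'] by simp
  then have "inj_on ?p E"
    using psep unit by (intro inj_onI) (force simp: unit_sphere_iff)
  then show "card (?p ` E) = card E"
    by (rule card_image)
qed

section \<open>The bound for hemisphere codes\<close>

theorem corollary4:
  fixes n :: nat and \<theta> \<theta>' :: real
  assumes "2 \<le> n"
    and "0 < \<theta>" and "\<theta> < pi / 2"
    and "\<theta>' \<in> {0..pi}" and "cos \<theta>' = cos \<theta> / cos (\<theta> / 2)"
  shows "real (max_hemisphere_code_size n \<theta>)
    \<le> (real (max_code_size (n - 1) \<theta>') + real (max_code_size n \<theta>)) / 2"
proof -
  obtain m where n: "n = Suc m"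
    using assms(1) by (cases n) auto
  have \<theta>: "0 < \<theta>" "\<theta> \<le> pi"
    using assms by auto
  have "cos \<theta> < cos (\<theta> / 2)" "0 < cos (\<theta> / 2)"
    using assms by (auto intro!: cos_monotone_0_pi cos_gt_zero_pi)
  then have "cos \<theta>' \<noteq> 1"
    using assms(5) by simp
  then have \<theta>': "0 < \<theta>'" "\<theta>' \<le> pi"
    using assms(4) by (auto simp: order_le_less)
  obtain C where C: "spherical_code n \<theta> C" "C \<subseteq> closed_hemisphere n"
    "card C = max_hemisphere_code_size n \<theta>"
    using max_hemisphere_code_size_attained[OF \<theta>] .
  define D where "D = {x \<in> C. sin (\<theta> / 2) \<le> x $ m}"
  define E where "E = C - D"
  have "card C + card D \<le> max_code_size n \<theta>"
    using spherical_code_add_reflections[OF \<theta> C(1,2)[unfolded n] D_def] card_le_max_code_size \<theta>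
    unfolding n by metis
  moreover have "card E \<le> max_code_size m \<theta>'"
  proof -
    have code: "spherical_code (Suc m) \<theta> E"
      using C(1) unfolding n by (auto simp: spherical_code_def E_def)
    have low: "0 \<le> x $ m \<and> x $ m < sin (\<theta> / 2)" if "x \<in> E" for x
      using that C(2) unfolding n by (auto simp: E_def D_def closed_hemisphere_Suc_iff)
    show ?thesis
      using spherical_code_equator_projection[OF assms(2,3) \<theta>' assms(5) code low]
        card_le_max_code_size \<theta>' by metis
  qed
  moreover have "card C = card D + card E"
  proof -
    have "finite C" "D \<subseteq> C"
      using C(1) by (auto simp: spherical_code_def D_def)
    then show ?thesis
      by (simp add: E_def card_Diff_subset card_mono finite_subset)
  qed
  ultimately have "2 * card C \<le> max_code_size m \<theta>' + max_code_size n \<theta>"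
    by linarith
  then show ?thesis
    using C(3) n by simp
qed

end
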